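(* Let $p>3$ be a prime and let $a$ be a positive integer. Then $$\sum_{k=0}^{p^a-1}\binom{2k}{k}\left(\frac{1-(-1)^{(p-1)/2}p}{4}\right)^k\equiv p^a\pmod{p^{a+1}}.$$ *)

theory Defs
  imports "HOL-Number_Theory.Number_Theory"
begin

text \<open>
  For odd \<open>p\<close>, the number \<open>(1 - (-1) ^ ((p - 1) div 2) * p) / 4\<close>
  is an integer, so integer division by 4 is exact here and agrees with the quotient in the rationals.
\<close>

lemma four_dvd_one_minus_signed:
  fixes p :: nat
  assumes "odd p"
  shows "(4::int) dvd 1 - (-1) ^ ((p - 1) div 2) * int p"
proof -
  from assms obtain m where m: "p = 2 * m + 1" by (auto elim: oddE)
  show ?thesis
  proof (cases "even m")
    case True
    then obtain j where "m = 2 * j" by (auto elim: evenE)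
    with m show ?thesis by simp
  next
    case False
    then obtain j where "m = 2 * j + 1" by (auto elim: oddE)
    with m have "1 - (-1) ^ ((p - 1) div 2) * int p = 4 * (int j + 1)" by simp
    then show ?thesis by (simp only: dvd_triv_left)
  qed
qed

lemma signed_quarter_exact:
  fixes p :: nat
  assumes "odd p"
  shows "of_int ((1 - (-1) ^ ((p - 1) div 2) * int p) div 4)
         = (1 - (-1) ^ ((p - 1) div 2) * of_nat p) / (4 :: rat)"
proof -
  obtain c where c: "1 - (-1) ^ ((p - 1) div 2) * int p = 4 * c"
    using four_dvd_one_minus_signed[OF assms] by (auto elim: dvdE)
  have "(1 - (-1) ^ ((p - 1) div 2) * of_nat p :: rat)
        = of_int (1 - (-1) ^ ((p - 1) div 2) * int p)" by simp
  also have "\<dots> = 4 * of_int c" by (simp only: c of_int_mult of_int_numeral)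
  finally have r: "1 - (-1) ^ ((p - 1) div 2) * of_nat p = (4 * of_int c :: rat)" .
  show ?thesis unfolding c r by simp
qed

end

theory Submission
  imports Defs
begin

text \<open>
  Write \<open>D = 1 - 4 x\<close> and \<open>J m = (\<integral>\<^sub>0\<^sup>1 (1 - D t\<^sup>2)\<^sup>m dt)\<close>, a polynomial in \<open>D\<close>. Integration by parts
  yields \<open>(2 m + 1) J m = 2 m J (m - 1) + (1 - D)\<^sup>m\<close>, and this recurrence shows that
  \<open>4\<^sup>n (\<Sum>k<n. (2k choose k) x\<^sup>k) = 2 n (2n choose n) J (n - 1)\<close>. If \<open>p\<close> divides \<open>D\<close> and \<open>p > 3\<close>, every
  term \<open>D\<^sup>j / (2 j + 1)\<close> with \<open>j > 0\<close> has positive \<open>p\<close>-adic valuation, so \<open>J (n - 1)\<close> is 1 modulo \<open>p\<close>.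
  For \<open>n = p\<^sup>a\<close> it remains to use \<open>2n choose n \<equiv> 2\<close> and \<open>4\<^sup>n \<equiv> 4\<close> modulo \<open>p\<close>.
\<close>

section \<open>Closed form of the partial sums\<close>

text \<open>This is the integral \<open>J m\<close>, expanded by the binomial theorem and integrated
  term by term.\<close>

definition moment :: "nat \<Rightarrow> rat \<Rightarrow> rat" where
  "moment m D = (\<Sum>j\<le>m. of_nat (m choose j) * (- D) ^ j / of_nat (2 * j + 1))"

text \<open>In place of integration by parts, the coefficients of \<open>(- D) ^ j\<close> are
  compared: 2(m+1-j) = (2m+3) - (2j+1), and absorption turns (m+1)(m choose j) into (m+1-j)(m+1
  choose j).\<close>

lemma moment_Suc:
  "of_nat (2 * m + 3) * moment (Suc m) D = of_nat (2 * m + 2) * moment m D + (1 - D) ^ Suc m"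
proof -
  \<comment> \<open>The added term \<open>j = Suc m\<close> vanishes, so that all sums share one
    range.\<close>
  have m: "moment m D = (\<Sum>j\<le>Suc m. of_nat (m choose j) * (- D) ^ j / of_nat (2 * j + 1))"
    by (simp add: moment_def binomial_eq_0)
  have b: "(1 - D) ^ Suc m = (\<Sum>j\<le>Suc m. of_nat (Suc m choose j) * (- D) ^ j)"
    using binomial_ring[of "- D" 1 "Suc m"] by simp
  have "of_nat (2 * m + 3) * (of_nat (Suc m choose j) * (- D) ^ j / of_nat (2 * j + 1)) =
      of_nat (2 * m + 2) * (of_nat (m choose j) * (- D) ^ j / of_nat (2 * j + 1)) +
      of_nat (Suc m choose j) * (- D) ^ j" if "j \<le> Suc m" for j
  proof -
    have "Suc m * (m choose j) = (Suc m - j) * (Suc m choose j)"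
      using binomial_absorb_comp[of "Suc m" j] by simp
    hence "rat_of_nat (Suc m * (m choose j)) = of_nat ((Suc m - j) * (Suc m choose j))"
      by (rule arg_cong)
    hence "(rat_of_nat m + 1) * of_nat (m choose j) =
        (of_nat m + 1 - of_nat j) * of_nat (Suc m choose j)"
      unfolding of_nat_mult of_nat_diff[OF that] by (simp add: add.commute del: binomial_Suc_Suc)
    hence k: "rat_of_nat (2 * m + 2) * of_nat (m choose j) =
        (of_nat (2 * m + 3) - of_nat (2 * j + 1)) * of_nat (Suc m choose j)"
      by (simp add: algebra_simps del: binomial_Suc_Suc)
    have nz: "rat_of_nat (2 * j + 1) \<noteq> 0"
      by (simp del: of_nat_add of_nat_mult of_nat_Suc)
    have "of_nat (2 * m + 2) * (of_nat (m choose j) * (- D) ^ j / of_nat (2 * j + 1)) =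
        (rat_of_nat (2 * m + 2) * of_nat (m choose j)) * (- D) ^ j / of_nat (2 * j + 1)"
      by (simp only: mult.assoc times_divide_eq_right)
    also have "\<dots> = of_nat (2 * m + 3) * (of_nat (Suc m choose j) * (- D) ^ j / of_nat (2 * j + 1)) -
        of_nat (Suc m choose j) * (- D) ^ j"
      unfolding k using nz
      by (simp add: field_simps del: binomial_Suc_Suc of_nat_add of_nat_mult of_nat_Suc)
    finally show ?thesis by simp
  qed
  thus ?thesis
    unfolding m b moment_def[of "Suc m"] sum_distrib_left sum.distrib[symmetric]
    by (intro sum.cong) auto
qed

text \<open>Absorption applies twice; in between, the symmetry of row 2n+1 moves the lower index
  from n to n+1.\<close>

lemma central_binomial_Suc:
  "Suc n * (2 * Suc n choose Suc n) = 2 * (2 * n + 1) * (2 * n choose n)"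
proof -
  have 1: "Suc n * (2 * Suc n choose Suc n) = (2 * n + 2) * (2 * n + 1 choose n)"
    using Suc_times_binomial_eq[of "2 * n + 1" n] by (simp add: mult.commute)
  have "2 * n + 1 choose n = 2 * n + 1 choose Suc n"
    using binomial_symmetric[of n "2 * n + 1"] by simp
  hence 2: "Suc n * (2 * n + 1 choose n) = (2 * n + 1) * (2 * n choose n)"
    using Suc_times_binomial_eq[of "2 * n" n] by (simp add: mult.commute)
  have "(2 * n + 2) * (2 * n + 1 choose n) = 2 * (Suc n * (2 * n + 1 choose n))"
    by simp
  with 1 2 show ?thesis by (simp only: mult.assoc)
qed

lemma central_binomial_sum:
  fixes x :: rat
  shows "4 ^ Suc m * (\<Sum>k\<le>m. of_nat (2 * k choose k) * x ^ k) =
    of_nat (2 * Suc m * (2 * Suc m choose Suc m)) * moment m (1 - 4 * x)"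
proof (induction m)
  case 0
  show ?case by (simp add: moment_def)
next
  case (Suc m)
  define c where "c = rat_of_nat (2 * Suc m choose Suc m)"
  define J where "J = moment m (1 - 4 * x)"
  have "rat_of_nat (2 * Suc (Suc m) * (2 * Suc (Suc m) choose Suc (Suc m))) =
      4 * of_nat (2 * m + 3) * c"
    using arg_cong[OF central_binomial_Suc[of "Suc m"], of "\<lambda>t. rat_of_nat (2 * t)"]
    by (simp add: c_def algebra_simps del: binomial_Suc_Suc)
  hence "rat_of_nat (2 * Suc (Suc m) * (2 * Suc (Suc m) choose Suc (Suc m))) *
      moment (Suc m) (1 - 4 * x) = 4 * c * (of_nat (2 * m + 3) * moment (Suc m) (1 - 4 * x))"
    by (simp only: mult_ac)
  \<comment> \<open>For D = 1 - 4x the inhomogeneous term of the recurrence is (4x)^(m+1), which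
    supplies exactly the new summand.\<close>
  also have "\<dots> = 4 * (of_nat (2 * m + 2) * c * J) + 4 * c * (4 * x) ^ Suc m"
    unfolding moment_Suc J_def[symmetric] by (simp add: algebra_simps)
  also have "of_nat (2 * m + 2) * c * J =
      4 ^ Suc m * (\<Sum>k\<le>m. of_nat (2 * k choose k) * x ^ k)"
    unfolding Suc.IH J_def c_def of_nat_mult[symmetric] by (simp only: mult_2_right mult_Suc_right) simp
  finally show ?case
    by (simp add: c_def algebra_simps power_mult_distrib del: binomial_Suc_Suc)
qed

section \<open>Divisibility by \<open>p\<close> in the localisation\<close>

text \<open>
  For prime \<open>p\<close>, the rationals of the form \<open>p u / v\<close> with \<open>p\<close> not dividing \<open>v\<close> are the maximal
  ideal of the localisation of the integers at \<open>p\<close>.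
\<close>

definition p_small :: "nat \<Rightarrow> rat \<Rightarrow> bool" where
  "p_small p q \<longleftrightarrow> (\<exists>u v. \<not> int p dvd v \<and> q * of_int v = of_nat p * of_int u)"

lemma p_small_0: "prime p \<Longrightarrow> p_small p 0"
  unfolding p_small_def by (rule exI[of _ 0], rule exI[of _ 1]) (auto simp: prime_nat_iff)

lemma p_small_add:
  assumes "prime p" "p_small p q" "p_small p r"
  shows "p_small p (q + r)"
proof -
  from assms obtain u v u' v' where
    v: "\<not> int p dvd v" "q * of_int v = of_nat p * of_int u" and
    v': "\<not> int p dvd v'" "r * of_int v' = of_nat p * of_int u'"
    unfolding p_small_def by blast
  have "\<not> int p dvd v * v'"
    using v(1) v'(1) assms(1) by (simp add: prime_dvd_mult_iff)
  moreover have "(q + r) * of_int (v * v') =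
      (q * of_int v) * of_int v' + (r * of_int v') * of_int v"
    by (simp add: algebra_simps)
  hence "(q + r) * of_int (v * v') = of_nat p * of_int (u * v' + u' * v)"
    unfolding v(2) v'(2) by (simp add: algebra_simps)
  ultimately show ?thesis unfolding p_small_def by blast
qed

lemma p_small_of_int_mult:
  assumes "p_small p q"
  shows "p_small p (of_int c * q)"
proof -
  from assms obtain u v where
    v: "\<not> int p dvd v" "q * of_int v = of_nat p * of_int u"
    unfolding p_small_def by blast
  have "of_int c * q * of_int v = of_int c * (q * of_int v)" by simp
  also have "\<dots> = of_nat p * of_int (c * u)" unfolding v(2) by simp
  finally show ?thesis using v(1) unfolding p_small_def by blast
qed

lemma p_small_sum:
  assumes "prime p" "\<And>i. i \<in> A \<Longrightarrow> p_small p (f i)"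
  shows "p_small p (sum f A)"
  using assms(2)
  by (induction A rule: infinite_finite_induct)
     (auto intro: p_small_0 p_small_add simp: assms(1))

lemma odd_less_power_5: "j > 0 \<Longrightarrow> 2 * j + 1 < (5::nat) ^ j"
  by (induction j rule: nat_induct_non_zero) auto

text \<open>This is where \<open>p > 3\<close> is needed: for \<open>p = 3\<close>, \<open>j = 1\<close> the quotient is a unit at \<open>p\<close>.\<close>

lemma p_small_power_div_odd:
  assumes "prime p" "p > 3" "int p dvd D" "j > 0"
  shows "p_small p (of_int D ^ j / of_nat (2 * j + 1))"
proof -
  have "p \<noteq> 4" using assms(1) by auto
  hence p5: "p \<ge> 5" using assms(2) by simp
  define e where "e = multiplicity p (2 * j + 1)"
  obtain w where w: "2 * j + 1 = p ^ e * w" "\<not> p dvd w"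
    unfolding e_def
    by (rule multiplicity_decompose'[of "2 * j + 1" p]) (use assms(1) in auto)
  \<comment> \<open>As p^e \<le> 2j+1 < 5^j \<le> p^j, cancelling p^e against \<open>D ^ j\<close>
    leaves at least one factor \<open>p\<close>.\<close>
  have "e < j"
  proof (rule ccontr)
    assume "\<not> e < j"
    hence "5 ^ j \<le> p ^ j" "p ^ j \<le> p ^ e"
      using p5 by (auto intro: power_mono power_increasing)
    moreover have "p ^ e \<le> 2 * j + 1"
      unfolding w(1) using w by (cases w) auto
    ultimately show False using odd_less_power_5[OF assms(4)] by linarith
  qed
  then obtain i where i: "j = e + Suc i"
    using less_imp_Suc_add by auto
  obtain d where d: "D = int p * d" using assms(3) by (elim dvdE)
  have p0: "rat_of_nat p \<noteq> 0" using p5 by simp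
  have w0: "rat_of_nat w \<noteq> 0" using w(2) by (cases "w = 0") auto
  have "rat_of_int D ^ j / of_nat (2 * j + 1) * of_int (int w) =
      of_nat p * of_int (int p ^ i * d ^ j)"
  proof -
    have D: "rat_of_int D ^ j = of_nat p ^ e * (of_nat p * of_int (int p ^ i * d ^ j))"
      unfolding d by (simp add: power_mult_distrib) (simp add: i power_add)
    show ?thesis unfolding D w(1) using p0 w0 by simp
  qed
  thus ?thesis using w(2) unfolding p_small_def by (metis int_dvd_int_iff)
qed

lemma p_small_moment_minus_1:
  assumes "prime p" "p > 3" "int p dvd D"
  shows "p_small p (moment m (of_int D) - 1)"
proof -
  have "moment m (of_int D) - 1 =
      (\<Sum>j\<in>{..m} - {0}. of_nat (m choose j) * (- of_int D) ^ j / of_nat (2 * j + 1))"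
    unfolding moment_def by (subst sum.remove[of _ 0]) auto
  also have "\<dots> = (\<Sum>j\<in>{..m} - {0}. of_int (int (m choose j)) *
      (of_int (- D) ^ j / of_nat (2 * j + 1)))"
    by simp
  also have "p_small p \<dots>"
    using assms by (intro p_small_sum p_small_of_int_mult p_small_power_div_odd) auto
  finally show ?thesis .
qed

section \<open>Congruences modulo \<open>p\<close> at prime powers\<close>

text \<open>By absorption p^a divides k (p^a choose k); if the binomial were prime to
  \<open>p\<close>, then p^a would divide the smaller positive number k.\<close>

lemma prime_dvd_choose_prime_power:
  assumes "prime (p::nat)" "0 < k" "k < p ^ a"
  shows "p dvd (p ^ a choose k)"
proof (rule ccontr)
  assume "\<not> ?thesis"
  hence "coprime (p ^ a) (p ^ a choose k)"
    using assms(1) by (simp add: prime_imp_coprime)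
  moreover have "k * (p ^ a choose k) = p ^ a * ((p ^ a - 1) choose (k - 1))"
    using times_binomial_minus1_eq[OF assms(2)] .
  hence "p ^ a dvd k * (p ^ a choose k)" by simp
  ultimately have "p ^ a dvd k" by (simp add: coprime_dvd_mult_left_iff)
  thus False using assms(2,3) by (auto dest: dvd_imp_le)
qed

text \<open>In the sum of squares of row p^a only the two end terms, both 1, survive modulo
  \<open>p\<close>.\<close>

lemma central_binomial_prime_power_cong:
  assumes "prime (p::nat)"
  shows "[2 * p ^ a choose p ^ a = 2] (mod p)"
proof -
  let ?n = "p ^ a"
  have n0: "?n > 0" using assms by (simp add: prime_gt_0_nat)
  have "(2 * ?n choose ?n) = (\<Sum>k\<le>?n. (?n choose k)\<^sup>2)"
    by (rule choose_square_sum[symmetric])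
  also have "{..?n} = insert 0 (insert ?n {0<..<?n})" using n0 by auto
  also have "(\<Sum>k\<in>\<dots>. (?n choose k)\<^sup>2) = 2 + (\<Sum>k\<in>{0<..<?n}. (?n choose k)\<^sup>2)"
    using n0 by simp
  finally have eq: "(2 * ?n choose ?n) = 2 + (\<Sum>k\<in>{0<..<?n}. (?n choose k)\<^sup>2)" .
  have "[(\<Sum>k\<in>{0<..<?n}. (?n choose k)\<^sup>2) = 0] (mod p)"
    unfolding cong_0_iff using assms
    by (intro dvd_sum) (auto simp: power2_eq_square prime_dvd_choose_prime_power)
  from cong_add[OF cong_refl[of 2] this] show ?thesis
    by (simp only: eq add_0_right)
qed

lemma power_prime_power_cong:
  assumes "prime (p::nat)" "\<not> p dvd b"
  shows "[b ^ (p ^ a) = b] (mod p)"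
proof (induction a)
  case (Suc a)
  have "[b ^ p = b] (mod p)"
    using cong_scalar_left[OF fermat_theorem[OF assms], of b] prime_gt_0_nat[OF assms(1)]
    by (simp add: power_eq_if)
  have "b ^ (p ^ Suc a) = (b ^ (p ^ a)) ^ p" by (simp add: power_mult[symmetric] mult.commute)
  also have "[\<dots> = b ^ p] (mod p)" by (rule cong_pow[OF Suc.IH])
  also have "[b ^ p = b] (mod p)" by fact
  finally show ?case .
qed simp

section \<open>The sum modulo p^(a+1)\<close>

lemma central_binomial_sum_prime_power_cong:
  fixes p a :: nat and x :: int
  assumes "prime p" "p > 3" "int p dvd 1 - 4 * x"
  shows "[(\<Sum>k<p ^ a. int (2 * k choose k) * x ^ k) = int p ^ a] (mod int p ^ (a + 1))"
proof -
  define n where "n = p ^ a"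
  define S where "S = (\<Sum>k<n. int (2 * k choose k) * x ^ k)"
  define C where "C = int (2 * n choose n)"
  have "n > 0" unfolding n_def using assms(2) by simp
  then obtain m where m: "n = Suc m" using gr0_implies_Suc by blast
  obtain u v where v: "\<not> int p dvd v"
    and "(moment m (of_int (1 - 4 * x)) - 1) * of_int v = of_nat p * of_int u"
    using p_small_moment_minus_1[OF assms] unfolding p_small_def by blast
  hence J: "moment m (of_int (1 - 4 * x)) * of_int v = of_int (v + int p * u)"
    by (simp add: algebra_simps)
  \<comment> \<open>Multiplying the closed form by the denominator \<open>v\<close> of the moment
    gives an identity of integers.\<close>
  have "rat_of_int (v * (4 ^ n * S)) =
      of_int v * (4 ^ Suc m * (\<Sum>k\<le>m. of_nat (2 * k choose k) * of_int x ^ k))"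
    by (simp add: S_def m lessThan_Suc_atMost)
  also have "\<dots> = of_int (2 * int n * C) * (moment m (of_int (1 - 4 * x)) * of_int v)"
    unfolding central_binomial_sum by (simp add: C_def m algebra_simps del: binomial_Suc_Suc)
  also have "\<dots> = rat_of_int (2 * int n * C * (v + int p * u))"
    unfolding J by simp
  finally have main: "v * (4 ^ n * S) = 2 * int n * C * (v + int p * u)"
    by (simp only: of_int_eq_iff)
  have "prime (int p)" using assms(1) by simp
  have "p \<noteq> 2" using assms(2) by simp
  hence "\<not> p dvd 2 ^ 2"
    using assms(1) prime_dvd_power[of p 2 2] primes_dvd_imp_eq[of p 2] by auto
  hence p4: "\<not> p dvd 4" by simp
  hence "\<not> int p dvd 4" by (metis int_dvd_int_iff of_nat_numeral)
  hence cop4: "coprime (int p) 4"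
    using \<open>prime (int p)\<close> by (rule prime_imp_coprime[rotated])
  have copv: "coprime (int p) v"
    using \<open>prime (int p)\<close> v by (rule prime_imp_coprime)
  \<comment> \<open>The factor \<open>n\<close> can thus be cancelled exactly, which leaves a
    congruence for \<open>s = S / n\<close> modulo \<open>p\<close> alone.\<close>
  have "coprime (int n) (v * 4 ^ n)"
    using cop4 copv by (simp add: n_def)
  moreover have "int n dvd (v * 4 ^ n) * S"
    using main by (simp add: mult.assoc)
  ultimately have "int n dvd S" by (simp add: coprime_dvd_mult_right_iff)
  then obtain s where s: "S = int n * s" by (elim dvdE)
  have "int n * (v * 4 ^ n * s) = int n * (2 * C * (v + int p * u))"
    using main unfolding s by (simp only: mult_ac)
  hence eq: "v * 4 ^ n * s = 2 * C * (v + int p * u)"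
    using \<open>n > 0\<close> by simp
  have "[4 ^ n = (4::int)] (mod int p)"
    using power_prime_power_cong[OF assms(1) p4, of a]
    unfolding n_def[symmetric] cong_int_iff[symmetric] by simp
  hence "[v * 4 ^ n * s = v * 4 * s] (mod int p)"
    by (intro cong_mult cong_refl)
  moreover have "[C = 2] (mod int p)"
    using central_binomial_prime_power_cong[OF assms(1), of a]
    unfolding n_def[symmetric] cong_int_iff[symmetric] C_def by simp
  hence "[2 * C * (v + int p * u) = 2 * 2 * (v + 0)] (mod int p)"
    by (intro cong_mult cong_add cong_refl) (auto simp: cong_0_iff)
  ultimately have "[v * 4 * s = v * 4 * 1] (mod int p)"
    unfolding eq by (simp add: cong_def mult.commute)
  moreover have "coprime (v * 4) (int p)"
    using cop4 copv by (simp add: coprime_commute)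
  ultimately have "[s = 1] (mod int p)"
    by (simp only: cong_mult_lcancel)
  \<comment> \<open>Restoring the factor n = p^a raises the modulus from p to p^(a+1).\<close>
  hence "[int n * s = int n * 1] (mod (int n * int p))"
    unfolding cong_iff_dvd_diff right_diff_distrib[symmetric] by (rule mult_dvd_mono[OF dvd_refl])
  thus ?thesis
    using s unfolding S_def n_def by (simp add: mult.commute)
qed

theorem corollary1p3:
  fixes p a :: nat
  assumes "prime p" and "p > 3" and "a > 0"
  shows "[(\<Sum>k = 0..p ^ a - 1. int ((2 * k) choose k) *
             ((1 - (-1) ^ ((p - 1) div 2) * int p) div 4) ^ k) = int p ^ a]
         (mod int p ^ (a + 1))"
proof -
  define x where "x = (1 - (-1) ^ ((p - 1) div 2) * int p) div 4"
  have "odd p" using assms(1,2) prime_odd_nat[of p] by simp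
  \<comment> \<open>Division by 4 is exact, so 1 - 4x is \<open>p\<close> up to sign.\<close>
  hence "4 * x = 1 - (-1) ^ ((p - 1) div 2) * int p"
    unfolding x_def by (intro dvd_mult_div_cancel four_dvd_one_minus_signed)
  hence "int p dvd 1 - 4 * x" by simp
  moreover have "p ^ a > 0" using assms(2) by simp
  hence "{0..p ^ a - 1} = {..<p ^ a}"
    by (simp add: atLeast0AtMost flip: lessThan_Suc_atMost)
  ultimately show ?thesis
    using central_binomial_sum_prime_power_cong[OF assms(1,2)] unfolding x_def by simp
qed

end
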